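(* Let $(x^t,y^t)_{t\ge 1}$ be generated by SPGM-IHT with parameter $\theta>0$, where $(\mu^t)_{t\ge 0}$ is either constant ($\mu^t=\bar\mu$) or diminishing ($\mu^t=\eta/(t+t_0)$). Let $\mathcal J^{t+1}:=\mathcal J(x^{t+1},y^{t+1};\mu^{t})$ for $t\ge 0$ and $\Psi^t:=\frac{L_h^2}{2}\big(\frac{(\mu^{t-1})^2}{\mu^t}-\mu^{t-1}\big)$ for $t\ge1$. Then: (a) For all $t\ge1$: $\frac{\theta}{2}\|x^{t+1}-x^t\|_2^2+\frac{1}{2\mu^0}\|y^{t+1}-y^t\|_2^2\le \Psi^t+\mathcal J^t-\mathcal J^{t+1}$. (b) For all $T\ge1$: $\sum_{t=1}^T\big[\frac{\theta}{2}\|x^{t+1}-x^t\|_2^2+\frac{1}{2\mu^0}\|y^{t+1}-y^t\|_2^2\big]\le C$, where $C:=\mathcal J^1-\mathcal J^{T+1}+\eta L_h^2<\infty$ (for constant $\mu^t$, $\eta>0$ is an arbitrary constant). (c) For every $\epsilon>0$, the algorithm finds an $\epsilon$-approximate Lipschitz stationary point in at most $\big\lceil \frac{2C}{\epsilon\min(\theta,(\mu^0)^{-1})}\big\rceil=\mathcal O(\epsilon^{-1})$ iterations; that is, whenever $T\ge1$ satisfies $T\ge \frac{2C}{\epsilon\min(\theta,(\mu^0)^{-1})}$ (with $C$ as in (b) for this $T$), there is $\bar t\in\{1,\dots,T\}$ such that $(x^{\bar t},y^{\bar t})$ is an $\epsilon$-approximate Lipschitz stationary point with smoothing parameter $\mu=\mu^{\bar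 t}$, and such a $T$ can be chosen of order $\mathcal O(\epsilon^{-1})$.
   Context: Setting. $A\in\mathbb R^{m\times n}$, $b\in\mathbb R^m$, $s\in\{1,\dots,n\}$; $f:\mathbb R^n\to\mathbb R$ is smooth and convex; $h:\mathbb R^m\to\mathbb R$ is convex, not necessarily smooth. $\|x\|_0$ is the number of nonzero entries; $\|\cdot\|$ is the Euclidean norm for vectors and spectral norm for matrices. The problem is $\min_x F(x):=f(x)+h(Ax-b)$ subject to $\|x\|_0\le s$. Standing assumptions. (1) $\|\nabla f(x)\|\le L_f$ for all $\|x\|_0\le s$, and every subgradient of $h$ at every $y\in\mathbb R^m$ has norm at most $L_h$; $L_F:=L_f+\|A\|L_h$. (2) There are $V_s,M_s>0$ with $\frac{V_s}{2}\|x-x'\|_2^2\le f(x')-f(x)-\langle x'-x,\nabla f(x)\rangle\le\frac{M_s}{2}\|x-x'\|_2^2$ for all $\|x\|_0\le s,\|x'\|_0\le s$, and a symmetric $\tilde M$ with $0\prec V_sI_n\preceq\tilde M\preceq M_sI_n$ and $f(x')-f(x)-\langle x'-x,\nabla f(x)\rangle\le\frac12 (x-x')^{\mathsf T}\tilde M(x-x')$ for all such $x,x'$. (3) There is $A_s>0$ with $\|A(x-x')\|\le A_s\|x-x'\|$ for all $\|x\|_0\le s,\|x'\|_0\le s$. Notation. $\delta(x)=0$ if $\|x\|_0\le s$ and $+\infty$ otherwise; $\mathcal R(x,y;\mu):=f(x)+\frac1{2\mu}\|Ax-b-y\|_2^2$; $\mathcal J(x,y;\mu):=\mathcal R(x,y;\mu)+h(y)+\delta(x)$;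 $\mathbb P_\mu(c):=\arg\min_y h(y)+\frac1{2\mu}\|c-y\|_2^2$. $\dot{\mathcal M}(x,x',y;\mu):=\mathcal R(x',y;\mu)+\langle x-x',\nabla_x\mathcal R(x',y;\mu)\rangle+\frac12\big(\frac{A_s^2}{\mu}+M_s+\theta\big)\|x-x'\|_2^2$. SPGM-IHT. Given $\theta>0$, $x^1$ with $\|x^1\|_0\le s$ and $y^1=\mathbb P_{\mu^0}(Ax^1-b)$, for $t=1,2,\dots$: $x^{t+1}\in\arg\min_{\|x\|_0\le s}\dot{\mathcal M}(x,x^t,y^t;\mu^t)$ and $y^{t+1}=\mathbb P_{\mu^t}(Ax^{t+1}-b)$. The parameters are either $\mu^t=\bar\mu$ for all $t$ ($\bar\mu>0$ a sufficiently small constant), or $\mu^t=\frac{\eta}{t+t_0}$ with constants $\eta>0$, $t_0\ge1$. Definition. For $\epsilon>0$ and (sufficiently small) $\mu>0$, $(\dot x,\dot y)$ is an $\epsilon$-approximate Lipschitz stationary point if $\mathrm{dist}^2(\dot y,\arg\min_y\mathcal J(\dot x,y;\mu))+\mathrm{dist}^2(\dot x,\arg\min_x\{\delta(x)+\dot{\mathcal M}(x,\dot x,\dot y;\mu)\})\le\epsilon$, where $\mathrm{dist}^2$ is the squared Euclidean distance to the set. *)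

theory Defs
  imports "HOL-Analysis.Analysis" "HOL-Library.Landau_Symbols"
begin

definition l0 :: "real ^ 'n \<Rightarrow> nat" where
  "l0 x = card {i. x $ i \<noteq> 0}"

definition gradient :: "('a::real_inner \<Rightarrow> real) \<Rightarrow> 'a \<Rightarrow> 'a" where
  "gradient f x = (THE D. GDERIV f x :> D)"

definition subdifferential :: "('a::real_inner \<Rightarrow> real) \<Rightarrow> 'a \<Rightarrow> 'a set" where
  "subdifferential h y = {g. \<forall>z. h y + g \<bullet> (z - y) \<le> h z}"

text \<open>The Loewner order; it is meant for symmetric matrices.\<close>

definition loewner_le :: "real ^ 'n ^ 'n \<Rightarrow> real ^ 'n ^ 'n \<Rightarrow> bool" where
  "loewner_le B C \<longleftrightarrow> (\<forall>u. 0 \<le> u \<bullet> ((C - B) *v u))"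

text \<open>The gradient bound is relativised to a region \<open>X\<close>. For \<open>X = UNIV\<close> it bounds the gradient
  at every \<open>s\<close>-sparse point, which cannot hold together with \<open>restricted_strong_smooth\<close> below:
  for \<open>V > 0\<close> and \<open>s \<ge> 1\<close> the gradient grows at least linearly along every coordinate axis.
  A region containing the iterates keeps the hypotheses consistent.\<close>

definition gradient_bounded_on ::
  "(real ^ 'n) set \<Rightarrow> nat \<Rightarrow> (real ^ 'n \<Rightarrow> real) \<Rightarrow> real \<Rightarrow> bool" where
  "gradient_bounded_on X s f L \<longleftrightarrow> (\<forall>x\<in>X. l0 x \<le> s \<longrightarrow> norm (gradient f x) \<le> L)"

definition restricted_strong_smooth ::
  "nat \<Rightarrow> (real ^ 'n \<Rightarrow> real) \<Rightarrow> real \<Rightarrow> real \<Rightarrow> bool" where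
  "restricted_strong_smooth s f V M \<longleftrightarrow>
     (\<forall>x x'. l0 x \<le> s \<and> l0 x' \<le> s \<longrightarrow>
        V / 2 * (norm (x - x'))\<^sup>2 \<le> f x' - f x - (x' - x) \<bullet> gradient f x \<and>
        f x' - f x - (x' - x) \<bullet> gradient f x \<le> M / 2 * (norm (x - x'))\<^sup>2)"

definition matrix_majorized ::
  "nat \<Rightarrow> (real ^ 'n \<Rightarrow> real) \<Rightarrow> real \<Rightarrow> real \<Rightarrow> real ^ 'n ^ 'n \<Rightarrow> bool" where
  "matrix_majorized s f V M Mt \<longleftrightarrow>
     transpose Mt = Mt \<and> loewner_le (V *\<^sub>R mat 1) Mt \<and> loewner_le Mt (M *\<^sub>R mat 1) \<and>
     (\<forall>x x'. l0 x \<le> s \<and> l0 x' \<le> s \<longrightarrow>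
        f x' - f x - (x' - x) \<bullet> gradient f x \<le> 1 / 2 * ((x - x') \<bullet> (Mt *v (x - x'))))"

definition sparse_ind :: "nat \<Rightarrow> real ^ 'n \<Rightarrow> ereal" where
  "sparse_ind s x = (if l0 x \<le> s then 0 else \<infinity>)"

definition smooth_part ::
  "(real ^ 'n \<Rightarrow> real) \<Rightarrow> real ^ 'n ^ 'm \<Rightarrow> real ^ 'm \<Rightarrow> real ^ 'n \<Rightarrow> real ^ 'm \<Rightarrow> real \<Rightarrow> real" where
  "smooth_part f A b x y \<mu> = f x + 1 / (2 * \<mu>) * (norm (A *v x - b - y))\<^sup>2"

definition penalty ::
  "(real ^ 'n \<Rightarrow> real) \<Rightarrow> (real ^ 'm \<Rightarrow> real) \<Rightarrow> real ^ 'n ^ 'm \<Rightarrow> real ^ 'm \<Rightarrow> nat \<Rightarrow>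
   real ^ 'n \<Rightarrow> real ^ 'm \<Rightarrow> real \<Rightarrow> ereal" where
  "penalty f h A b s x y \<mu> = ereal (smooth_part f A b x y \<mu> + h y) + sparse_ind s x"

definition prox :: "(real ^ 'm \<Rightarrow> real) \<Rightarrow> real \<Rightarrow> real ^ 'm \<Rightarrow> real ^ 'm" where
  "prox h \<mu> c = arg_min (\<lambda>y. h y + 1 / (2 * \<mu>) * (norm (c - y))\<^sup>2) (\<lambda>_. True)"

definition majorant ::
  "(real ^ 'n \<Rightarrow> real) \<Rightarrow> real ^ 'n ^ 'm \<Rightarrow> real ^ 'm \<Rightarrow> real \<Rightarrow> real \<Rightarrow> real \<Rightarrow>
   real ^ 'n \<Rightarrow> real ^ 'n \<Rightarrow> real ^ 'm \<Rightarrow> real \<Rightarrow> real" where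
  "majorant f A b As Ms \<theta> x x' y \<mu> =
     smooth_part f A b x' y \<mu>
     + (x - x') \<bullet> gradient (\<lambda>z. smooth_part f A b z y \<mu>) x'
     + 1 / 2 * (As\<^sup>2 / \<mu> + Ms + \<theta>) * (norm (x - x'))\<^sup>2"

text \<open>The iterates are \<open>x t\<close>, \<open>y t\<close> for \<open>t \<ge> 1\<close>; the values \<open>x 0\<close> and \<open>y 0\<close> are junk.\<close>

definition spgm_iht ::
  "(real ^ 'n \<Rightarrow> real) \<Rightarrow> (real ^ 'm \<Rightarrow> real) \<Rightarrow> real ^ 'n ^ 'm \<Rightarrow> real ^ 'm \<Rightarrow> nat \<Rightarrow>
   real \<Rightarrow> real \<Rightarrow> real \<Rightarrow> (nat \<Rightarrow> real) \<Rightarrow>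
   (nat \<Rightarrow> real ^ 'n) \<Rightarrow> (nat \<Rightarrow> real ^ 'm) \<Rightarrow> bool" where
  "spgm_iht f h A b s As Ms \<theta> \<mu> x y \<longleftrightarrow>
     l0 (x 1) \<le> s \<and> y 1 = prox h (\<mu> 0) (A *v x 1 - b) \<and>
     (\<forall>t\<ge>1. is_arg_min (\<lambda>z. majorant f A b As Ms \<theta> z (x t) (y t) (\<mu> t))
                (\<lambda>z. l0 z \<le> s) (x (t + 1)) \<and>
             y (t + 1) = prox h (\<mu> t) (A *v x (t + 1) - b))"

definition constant_schedule :: "(nat \<Rightarrow> real) \<Rightarrow> bool" where
  "constant_schedule \<mu> \<longleftrightarrow> (\<exists>\<mu>bar>0. \<forall>t. \<mu> t = \<mu>bar)"

definition diminishing_schedule :: "real \<Rightarrow> (nat \<Rightarrow> real) \<Rightarrow> bool" where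
  "diminishing_schedule \<eta> \<mu> \<longleftrightarrow> (\<exists>t0\<ge>1. \<forall>t. \<mu> t = \<eta> / (real t + t0))"

text \<open>Each of the next two is used for \<open>t \<ge> 1\<close> only, so \<open>t - 1\<close> is not truncated.\<close>

definition J_iter ::
  "(real ^ 'n \<Rightarrow> real) \<Rightarrow> (real ^ 'm \<Rightarrow> real) \<Rightarrow> real ^ 'n ^ 'm \<Rightarrow> real ^ 'm \<Rightarrow> nat \<Rightarrow>
   (nat \<Rightarrow> real) \<Rightarrow> (nat \<Rightarrow> real ^ 'n) \<Rightarrow> (nat \<Rightarrow> real ^ 'm) \<Rightarrow> nat \<Rightarrow> ereal" where
  "J_iter f h A b s \<mu> x y t = penalty f h A b s (x t) (y t) (\<mu> (t - 1))"

definition Psi :: "real \<Rightarrow> (nat \<Rightarrow> real) \<Rightarrow> nat \<Rightarrow> real" where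
  "Psi Lh \<mu> t = Lh\<^sup>2 / 2 * ((\<mu> (t - 1))\<^sup>2 / \<mu> t - \<mu> (t - 1))"

definition C_bound ::
  "(real ^ 'n \<Rightarrow> real) \<Rightarrow> (real ^ 'm \<Rightarrow> real) \<Rightarrow> real ^ 'n ^ 'm \<Rightarrow> real ^ 'm \<Rightarrow> nat \<Rightarrow>
   real \<Rightarrow> real \<Rightarrow> (nat \<Rightarrow> real) \<Rightarrow> (nat \<Rightarrow> real ^ 'n) \<Rightarrow> (nat \<Rightarrow> real ^ 'm) \<Rightarrow> nat \<Rightarrow> ereal" where
  "C_bound f h A b s Lh \<eta> \<mu> x y T =
     J_iter f h A b s \<mu> x y 1 - J_iter f h A b s \<mu> x y (T + 1) + ereal (\<eta> * Lh\<^sup>2)"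

text \<open>The distance to the empty set is infinite in the source but \<open>infdist x {} = 0\<close>, hence the
  two nonemptiness requirements.\<close>

definition approx_lipschitz_stationary ::
  "(real ^ 'n \<Rightarrow> real) \<Rightarrow> (real ^ 'm \<Rightarrow> real) \<Rightarrow> real ^ 'n ^ 'm \<Rightarrow> real ^ 'm \<Rightarrow> nat \<Rightarrow>
   real \<Rightarrow> real \<Rightarrow> real \<Rightarrow> real \<Rightarrow> real \<Rightarrow> real ^ 'n \<Rightarrow> real ^ 'm \<Rightarrow> bool" where
  "approx_lipschitz_stationary f h A b s As Ms \<theta> \<epsilon> \<mu> xd yd \<longleftrightarrow>
     (let Y = {y. is_arg_min (\<lambda>y. penalty f h A b s xd y \<mu>) (\<lambda>_. True) y};
          X = {x. is_arg_min (\<lambda>x. sparse_ind s x + ereal (majorant f A b As Ms \<theta> x xd yd \<mu>))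
                    (\<lambda>_. True) x}
      in Y \<noteq> {} \<and> X \<noteq> {} \<and> (infdist yd Y)\<^sup>2 + (infdist xd X)\<^sup>2 \<le> \<epsilon>)"

end

theory Submission
  imports Defs
begin

text \<open>
  The penalised objective \<open>J\<close> is a Lyapunov function of the iteration, up to the cost of changing the
  smoothing parameter. One iteration decreases it through the proximity term of the majorant in
  \<open>x\<close> (\<open>majorant_ge_smooth_part\<close>) and through the strong convexity of the proximal objective in
  \<open>y\<close> (\<open>prox_strong_minimizer\<close>). Lowering the parameter from \<open>\<mu>\<^sup>t\<^sup>-\<^sup>1\<close> to \<open>\<mu>\<^sup>t\<close> increases it by at most
  \<open>\<Psi>\<^sup>t\<close>, because the residual of a proximal step is \<open>\<mu>\<^sup>t\<^sup>-\<^sup>1\<close> times a subgradient of \<open>h\<close> and these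
  are bounded. This is part (a) (\<open>spgm_iht_step_descent\<close>). Part (b) is its sum over the iterations,
  since the \<open>\<Psi>\<^sup>t\<close> add up to at most \<open>\<eta> L\<^sub>h\<^sup>2\<close>.

  Part (c) does not follow from (b) by pigeonhole alone. The point \<open>x\<^sup>t\<^sup>+\<^sup>1\<close> belongs to the argmin set
  whose distance from \<open>x\<^sup>t\<close> is to be bounded, but \<open>y\<^sup>t\<^sup>+\<^sup>1\<close> need not belong to the other one: the
  minimiser over \<open>y\<close> of \<open>J(x\<^sup>t, y; \<mu>\<^sup>t)\<close> is the proximal point of \<open>A x\<^sup>t - b\<close> for \<open>\<mu>\<^sup>t\<close>, while \<open>y\<^sup>t\<close>
  is the proximal point of the same vector for \<open>\<mu>\<^sup>t\<^sup>-\<^sup>1\<close>. These are at most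
  \<open>L\<^sub>h (\<mu>\<^sup>t\<^sup>-\<^sup>1 - \<mu>\<^sup>t)\<close> apart (\<open>prox_parameter_lipschitz\<close>). The squares of these drifts, weighted
  by \<open>1 / (2 \<mu>\<^sup>0)\<close>, fit together with all \<open>\<Psi>\<^sup>t\<close> into the budget \<open>\<eta> L\<^sub>h\<^sup>2\<close>
  (\<open>schedule_drift_sum_le\<close>). Hence the inequality of (b) stays true with the drift in place of
  \<open>y\<^sup>t\<^sup>+\<^sup>1 - y\<^sup>t\<close>, and the smallest of the \<open>T\<close> summands gives the stationary iterate.

  Finally, \<open>J\<close> is bounded below along the iterates (\<open>objective_bounded_below\<close>), so \<open>C\<close> is bounded
  uniformly in \<open>T\<close>, and a number of iterations of order \<open>1 / \<epsilon>\<close> suffices.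
\<close>

section \<open>The proximal map of a convex function\<close>

text \<open>Finite-valued convex functions on a Euclidean space decrease at most linearly. Let \<open>q\<close> minimise
  \<open>h\<close> on the closed unit ball around \<open>c\<close>. A point \<open>y\<close> at distance \<open>r > 1\<close> from \<open>c\<close> sees the unit
  sphere on its segment to \<open>c\<close>, and convexity on that segment gives
  \<open>h y \<ge> h c - r (h c - h q)\<close>. The bound makes the proximal objective and the penalised objective
  coercive.\<close>

lemma convex_linear_minorant:
  fixes h :: "'a::euclidean_space \<Rightarrow> real"
  assumes h: "convex_on UNIV h"
  obtains K where "0 \<le> K" "\<And>y. h c - K * (1 + norm (y - c)) \<le> h y"
proof -
  have "continuous_on (cball c 1) h"
    using convex_on_continuous[OF open_UNIV h] continuous_on_subset by blast
  moreover have "cball c 1 \<noteq> {}"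
    by simp
  ultimately obtain q where q: "\<And>y. y \<in> cball c 1 \<Longrightarrow> h q \<le> h y"
    using continuous_attains_inf[of "cball c 1" h] compact_cball by blast
  define K where "K = h c - h q"
  have K: "0 \<le> K"
    using q[of c] by (simp add: K_def)
  have "h c - K * (1 + norm (y - c)) \<le> h y" for y
  proof (cases "norm (y - c) \<le> 1")
    case True
    then have "h q \<le> h y"
      by (intro q) (simp add: dist_norm norm_minus_commute)
    moreover have "0 \<le> K * norm (y - c)"
      using K by simp
    ultimately show ?thesis
      by (simp add: K_def algebra_simps)
  next
    case False
    define r where "r = norm (y - c)"
    have r: "1 < r"
      using False by (simp add: r_def)
    define u where "u = (1 - 1 / r) *\<^sub>R c + (1 / r) *\<^sub>R y"
    have "u - c = (1 / r) *\<^sub>R (y - c)"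
      by (simp add: u_def algebra_simps)
    then have "norm (u - c) = 1"
      using r by (simp add: r_def[symmetric])
    then have "h q \<le> h u"
      by (intro q) (simp add: dist_norm norm_minus_commute)
    also have "h u \<le> (1 - 1 / r) * h c + 1 / r * h y"
      unfolding u_def using convex_onD[OF h, of "1 / r" c y] r by simp
    finally have "h q * r \<le> ((1 - 1 / r) * h c + 1 / r * h y) * r"
      using r by (intro mult_right_mono) auto
    also have "\<dots> = (r - 1) * h c + h y"
      using r by (simp add: field_simps)
    finally have "h c - K * r \<le> h y"
      by (simp add: K_def algebra_simps)
    then show ?thesis
      using K unfolding r_def by (simp add: algebra_simps)
  qed
  then show ?thesis
    using K that by blast
qed

text \<open>The proximal objective attains its infimum: its quadratic term beats the linear decrease allowed
  by the preceding lemma, so only a large ball around \<open>c\<close> has to be searched.\<close>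

lemma prox_minimizes:
  fixes h :: "real ^ 'm \<Rightarrow> real"
  assumes h: "convex_on UNIV h" and \<mu>: "0 < \<mu>"
  shows "h (prox h \<mu> c) + 1 / (2 * \<mu>) * (norm (c - prox h \<mu> c))\<^sup>2
    \<le> h z + 1 / (2 * \<mu>) * (norm (c - z))\<^sup>2"
proof -
  define G where "G y = h y + 1 / (2 * \<mu>) * (norm (c - y))\<^sup>2" for y
  obtain K where K: "0 \<le> K" "\<And>y. h c - K * (1 + norm (y - c)) \<le> h y"
    using convex_linear_minorant[OF h] by blast
  (* Beyond this radius r\<^sup>2 / (2 \<mu>) dominates K (1 + r), and r \<ge> 1 allows 1 + r \<le> 2 r. *)
  define R where "R = max 1 (4 * \<mu> * K)"
  have "continuous_on (cball c R) h"
    using convex_on_continuous[OF open_UNIV h] continuous_on_subset by blast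
  then have "continuous_on (cball c R) G"
    unfolding G_def by (intro continuous_intros) auto
  moreover have "cball c R \<noteq> {}"
    by (simp add: R_def)
  ultimately obtain q where q: "\<And>y. y \<in> cball c R \<Longrightarrow> G q \<le> G y"
    using continuous_attains_inf[of "cball c R" G] compact_cball by blast
  have min: "G q \<le> G y" for y
  proof (cases "y \<in> cball c R")
    case True
    then show ?thesis by (rule q)
  next
    case False
    define r where "r = norm (y - c)"
    have r: "1 \<le> r" "4 * \<mu> * K \<le> r"
      using False by (auto simp: R_def r_def dist_norm norm_minus_commute)
    have "K * (1 + r) \<le> 2 * K * r"
      using r K mult_left_mono[of 1 r K] by (simp add: algebra_simps)
    also have "\<dots> = 1 / (2 * \<mu>) * (4 * \<mu> * K * r)"
      using \<mu> by (simp add: field_simps)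
    also have "\<dots> \<le> 1 / (2 * \<mu>) * (r * r)"
      using r \<mu> by (intro mult_left_mono mult_right_mono) auto
    finally have "K * (1 + r) \<le> 1 / (2 * \<mu>) * r\<^sup>2"
      by (simp add: power2_eq_square)
    then have "h c \<le> G y"
      using K(2)[of y] unfolding G_def r_def by (simp add: norm_minus_commute)
    moreover have "G q \<le> h c"
      using q[of c] by (simp add: G_def R_def)
    ultimately show ?thesis by simp
  qed
  have "is_arg_min G (\<lambda>_. True) (prox h \<mu> c)"
    unfolding prox_def G_def[symmetric]
    by (rule arg_minI[of "\<lambda>_. True" q]) (auto simp: is_arg_min_def not_less min)
  then show ?thesis
    by (auto simp: is_arg_min_linorder G_def)
qed

text \<open>Fermat's rule. Moving from the minimiser \<open>p\<close> a fraction \<open>l\<close> of the way to \<open>z\<close> changes \<open>h\<close>, by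
  convexity, by at most \<open>l (h z - h p)\<close>, while the quadratic term falls by
  \<open>l \<langle>c - p, z - p\<rangle> / \<mu>\<close> up to order \<open>l\<^sup>2\<close>. Dividing by \<open>l\<close> and letting \<open>l\<close> tend to 0
  leaves the subgradient inequality.\<close>

lemma prox_subgradient:
  fixes h :: "real ^ 'm \<Rightarrow> real"
  assumes h: "convex_on UNIV h" and \<mu>: "0 < \<mu>"
  shows "(1 / \<mu>) *\<^sub>R (c - prox h \<mu> c) \<in> subdifferential h (prox h \<mu> c)"
  unfolding subdifferential_def
proof (intro CollectI allI)
  fix z
  define p where "p = prox h \<mu> c"
  define g where "g = (1 / \<mu>) *\<^sub>R (c - p)"
  define k where "k = 1 / (2 * \<mu>)"
  define I where "I = (c - p) \<bullet> (z - p)"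
  define N where "N = (norm (z - p))\<^sup>2"
  define D where "D = k * N"
  have g: "g \<bullet> (z - p) = 2 * k * I"
    by (simp add: g_def k_def I_def)
  have step: "g \<bullet> (z - p) \<le> h z - h p + D * l" if l: "0 < l" "l < 1" for l :: real
  proof -
    define w where "w = (1 - l) *\<^sub>R p + l *\<^sub>R z"
    have "h p + k * (norm (c - p))\<^sup>2 \<le> h w + k * (norm (c - w))\<^sup>2"
      unfolding p_def k_def by (rule prox_minimizes[OF h \<mu>])
    also have "h w \<le> (1 - l) * h p + l * h z"
      unfolding w_def using convex_onD[OF h, of l p z] l by simp
    also have "c - w = (c - p) - l *\<^sub>R (z - p)"
      by (simp add: w_def algebra_simps)
    also have "(norm ((c - p) - l *\<^sub>R (z - p)))\<^sup>2
        = (norm (c - p))\<^sup>2 - 2 * l * I + l * (l * N)"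
      unfolding power2_norm_eq_inner I_def N_def
      by (simp add: inner_diff_left inner_diff_right inner_commute power2_eq_square algebra_simps)
    finally have "h p + k * (norm (c - p))\<^sup>2 \<le> (1 - l) * h p + l * h z
        + k * ((norm (c - p))\<^sup>2 - 2 * l * I + l * (l * N))"
      by simp
    then have "l * (g \<bullet> (z - p)) \<le> l * (h z - h p + D * l)"
      unfolding g D_def by (simp add: algebra_simps)
    then show ?thesis
      using l by simp
  qed
  have "((\<lambda>l. h z - h p + D * l) \<longlongrightarrow> h z - h p + D * 0) (at_right 0)"
    by (intro tendsto_intros)
  moreover have "\<forall>\<^sub>F l in at_right 0. g \<bullet> (z - p) \<le> h z - h p + D * l"
    using eventually_at_right_real[of 0 1] by (rule eventually_mono) (auto intro: step)
  ultimately have "g \<bullet> (z - p) \<le> h z - h p + D * 0"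
    by (rule tendsto_lowerbound) simp
  then show "h (prox h \<mu> c) + (1 / \<mu>) *\<^sub>R (c - prox h \<mu> c) \<bullet> (z - prox h \<mu> c) \<le> h z"
    unfolding g_def p_def by simp
qed

text \<open>The proximal objective is \<open>1 / \<mu>\<close>-strongly convex, so its values grow quadratically away from the
  minimiser: this is the subgradient inequality at \<open>p\<close> with \<open>\<parallel>c - z\<parallel>\<^sup>2\<close> expanded around \<open>p\<close>.\<close>

lemma prox_strong_minimizer:
  fixes h :: "real ^ 'm \<Rightarrow> real"
  assumes h: "convex_on UNIV h" and \<mu>: "0 < \<mu>"
  shows "h (prox h \<mu> c) + 1 / (2 * \<mu>) * (norm (c - prox h \<mu> c))\<^sup>2
      + 1 / (2 * \<mu>) * (norm (z - prox h \<mu> c))\<^sup>2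
    \<le> h z + 1 / (2 * \<mu>) * (norm (c - z))\<^sup>2"
proof -
  define p where "p = prox h \<mu> c"
  define k where "k = 1 / (2 * \<mu>)"
  define I where "I = (c - p) \<bullet> (z - p)"
  have "h p + ((1 / \<mu>) *\<^sub>R (c - p)) \<bullet> (z - p) \<le> h z"
    using prox_subgradient[OF h \<mu>, of c] by (simp add: subdifferential_def p_def)
  then have 1: "h p + 2 * k * I \<le> h z"
    by (simp add: k_def I_def)
  have "c - z = (c - p) - (z - p)"
    by simp
  then have 2: "(norm (c - z))\<^sup>2 = (norm (c - p))\<^sup>2 - 2 * I + (norm (z - p))\<^sup>2"
    unfolding power2_norm_eq_inner I_def
    by (simp only: inner_diff_left inner_diff_right inner_commute algebra_simps)
  have "k * (norm (c - z))\<^sup>2 = k * (norm (c - p))\<^sup>2 - 2 * k * I + k * (norm (z - p))\<^sup>2"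
    unfolding 2 by (simp add: algebra_simps)
  then show ?thesis
    using 1 unfolding p_def[symmetric] k_def[symmetric] by simp
qed


lemma prox_residual_bound:
  fixes h :: "real ^ 'm \<Rightarrow> real"
  assumes h: "convex_on UNIV h" and \<mu>: "0 < \<mu>"
    and L: "\<And>z g. g \<in> subdifferential h z \<Longrightarrow> norm g \<le> L"
  shows "norm (c - prox h \<mu> c) \<le> L * \<mu>"
proof -
  have "norm (c - prox h \<mu> c) / \<mu> \<le> L"
    using L[OF prox_subgradient[OF h \<mu>, of c]] \<mu> by simp
  then show ?thesis
    using pos_divide_le_eq[OF \<mu>] by blast
qed

text \<open>Both proximal points have a scaled residual which is a subgradient, and subgradients are
  monotone. Testing \<open>p - q = \<nu> (gq - gp) - (\<mu> - \<nu>) gp\<close> against \<open>p - q\<close> therefore leaves only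
  the contribution of the second term, whose size is controlled by the subgradient bound.\<close>

lemma prox_parameter_lipschitz:
  fixes h :: "real ^ 'm \<Rightarrow> real"
  assumes h: "convex_on UNIV h" and \<nu>: "0 < \<nu>" "\<nu> \<le> \<mu>"
    and L: "\<And>z g. g \<in> subdifferential h z \<Longrightarrow> norm g \<le> L"
  shows "norm (prox h \<mu> c - prox h \<nu> c) \<le> L * (\<mu> - \<nu>)"
proof -
  define p where "p = prox h \<mu> c"
  define q where "q = prox h \<nu> c"
  define gp where "gp = (1 / \<mu>) *\<^sub>R (c - p)"
  define gq where "gq = (1 / \<nu>) *\<^sub>R (c - q)"
  have \<mu>: "0 < \<mu>"
    using \<nu> by simp
  have sp: "gp \<in> subdifferential h p" and sq: "gq \<in> subdifferential h q"
    unfolding gp_def p_def gq_def q_def using prox_subgradient[OF h] \<mu> \<nu> by auto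
  have "h p + gp \<bullet> (q - p) \<le> h q" "h q + gq \<bullet> (p - q) \<le> h p"
    using sp sq by (auto simp: subdifferential_def)
  then have mono: "0 \<le> (p - q) \<bullet> (gp - gq)"
    by (simp add: inner_diff_left inner_diff_right inner_commute)
  have "\<mu> *\<^sub>R gp = c - p" "\<nu> *\<^sub>R gq = c - q"
    unfolding gp_def gq_def using \<mu> \<nu> by simp_all
  then have "p - q = \<nu> *\<^sub>R (gq - gp) - (\<mu> - \<nu>) *\<^sub>R gp"
    by (simp add: scaleR_diff_left scaleR_diff_right)
  then have "(p - q) \<bullet> (p - q) = (p - q) \<bullet> (\<nu> *\<^sub>R (gq - gp) - (\<mu> - \<nu>) *\<^sub>R gp)"
    by simp
  also have "\<dots> = - \<nu> * ((p - q) \<bullet> (gp - gq)) - (\<mu> - \<nu>) * ((p - q) \<bullet> gp)"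
    by (simp add: inner_diff_right algebra_simps)
  also have "\<dots> \<le> (\<mu> - \<nu>) * - ((p - q) \<bullet> gp)"
    using mono \<nu> by simp
  also have "\<dots> \<le> (\<mu> - \<nu>) * (norm (p - q) * L)"
  proof (intro mult_left_mono)
    have "- ((p - q) \<bullet> gp) \<le> norm (p - q) * norm gp"
      using Cauchy_Schwarz_ineq2[of "p - q" gp] by linarith
    also have "\<dots> \<le> norm (p - q) * L"
      by (intro mult_left_mono L[OF sp]) simp
    finally show "- ((p - q) \<bullet> gp) \<le> norm (p - q) * L" .
  qed (use \<nu> in simp)
  finally have "norm (p - q) * norm (p - q) \<le> norm (p - q) * (L * (\<mu> - \<nu>))"
    unfolding power2_norm_eq_inner[symmetric] power2_eq_square by (simp add: algebra_simps)
  moreover have "0 \<le> L * (\<mu> - \<nu>)"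
    using order_trans[OF norm_ge_zero L[OF sp]] \<nu> by (intro mult_nonneg_nonneg) auto
  ultimately have "norm (p - q) \<le> L * (\<mu> - \<nu>)"
    by (cases "p = q") auto
  then show ?thesis
    unfolding p_def q_def .
qed

section \<open>Gradients and the majorant\<close>


lemma gradient_eqI:
  fixes f :: "'a::real_inner \<Rightarrow> real"
  assumes "GDERIV f x :> D"
  shows "gradient f x = D"
  unfolding gradient_def
proof (rule the_equality)
  show "GDERIV f x :> D" by fact
  fix D' assume "GDERIV f x :> D'"
  then have "(\<lambda>h. h \<bullet> D') = (\<lambda>h. h \<bullet> D)"
    using assms unfolding gderiv_def by (rule has_derivative_unique)
  then have "(D' - D) \<bullet> D' = (D' - D) \<bullet> D"
    by meson
  then have "(D' - D) \<bullet> (D' - D) = 0"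
    by (simp only: inner_diff_right diff_self)
  then show "D' = D"
    by simp
qed

lemma GDERIV_gradient:
  fixes f :: "'a::euclidean_space \<Rightarrow> real"
  assumes "f differentiable (at x)"
  shows "GDERIV f x :> gradient f x"
proof -
  obtain D where D: "(f has_derivative D) (at x)"
    using assms by (auto simp: differentiable_def)
  then have "linear D"
    by (rule has_derivative_linear)
  then have "D = (\<lambda>v. v \<bullet> adjoint D 1)"
    by (simp add: adjoint_works fun_eq_iff)
  then have "GDERIV f x :> adjoint D 1"
    using D unfolding gderiv_def by simp
  then show ?thesis
    using gradient_eqI by metis
qed

text \<open>The factor \<open>1 / (2 * \<mu>)\<close> is kept so that the term is literally the cross term of the expanded
  square in \<open>majorant_ge_smooth_part\<close>.\<close>

lemma inner_gradient_smooth_part: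
  fixes A :: "real ^ 'n ^ 'm"
  assumes "f differentiable (at x)"
  shows "v \<bullet> gradient (\<lambda>z. smooth_part f A b z y \<mu>) x
    = v \<bullet> gradient f x + 1 / (2 * \<mu>) * (2 * ((A *v v) \<bullet> (A *v x - b - y)))"
proof -
  define D where "D = gradient f x + (1 / \<mu>) *\<^sub>R ((A *v x - b - y) v* A)"
  have tr: "v \<bullet> (w v* A) = (A *v v) \<bullet> w" for v w
    by (metis dot_lmul_matrix inner_commute)
  have "((\<lambda>z. smooth_part f A b z y \<mu>) has_derivative (\<lambda>v. v \<bullet> D)) (at x)"
    unfolding smooth_part_def power2_norm_eq_inner
    by (rule has_derivative_eq_rhs,
        (rule derivative_intros GDERIV_gradient[OF assms, unfolded gderiv_def]
          bounded_linear.has_derivative[OF matrix_vector_mul_bounded_linear])+)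
      (simp add: fun_eq_iff D_def inner_add_right tr inner_commute)
  then have "gradient (\<lambda>z. smooth_part f A b z y \<mu>) x = D"
    by (intro gradient_eqI) (simp add: gderiv_def)
  then show ?thesis
    by (simp add: D_def inner_add_right tr)
qed

text \<open>The penalty is exactly quadratic in \<open>x\<close>, with second-order term
  \<open>\<parallel>A (z - x)\<parallel>\<^sup>2 / (2 \<mu>)\<close>; on sparse points it is at most
  \<open>a\<^sup>2 \<parallel>z - x\<parallel>\<^sup>2 / (2 \<mu>)\<close>. Adding the upper curvature bound of \<open>f\<close> explains all of the majorant's
  quadratic coefficient except \<open>\<theta>\<close>, which is the surplus on the left.\<close>

lemma majorant_ge_smooth_part:
  fixes A :: "real ^ 'n ^ 'm"
  assumes f: "f differentiable (at x)"
    and M: "restricted_strong_smooth s f V M"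
    and A: "\<And>z z'. l0 z \<le> s \<Longrightarrow> l0 z' \<le> s \<Longrightarrow> norm (A *v (z - z')) \<le> a * norm (z - z')"
    and \<mu>: "0 < \<mu>" and x: "l0 x \<le> s" and z: "l0 z \<le> s"
  shows "smooth_part f A b z y \<mu> + \<theta> / 2 * (norm (z - x))\<^sup>2 \<le> majorant f A b a M \<theta> z x y \<mu>"
proof -
  define r where "r = A *v x - b - y"
  define w where "w = A *v (z - x)"
  have "f z - f x - (z - x) \<bullet> gradient f x \<le> M / 2 * (norm (z - x))\<^sup>2"
    using M x z unfolding restricted_strong_smooth_def by (metis norm_minus_commute)
  moreover have "(norm w)\<^sup>2 \<le> a\<^sup>2 * (norm (z - x))\<^sup>2"
    unfolding w_def power_mult_distrib[symmetric] by (intro power_mono A x z) simp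
  then have "1 / (2 * \<mu>) * (norm w)\<^sup>2 \<le> 1 / (2 * \<mu>) * (a\<^sup>2 * (norm (z - x))\<^sup>2)"
    using \<mu> by (intro mult_left_mono) auto
  moreover have "A *v z - b - y = r + w"
    by (simp add: r_def w_def matrix_vector_mult_diff_distrib)
  then have "(norm (A *v z - b - y))\<^sup>2 = (norm r)\<^sup>2 + 2 * (w \<bullet> r) + (norm w)\<^sup>2"
    unfolding power2_norm_eq_inner by (simp add: inner_add_left inner_add_right inner_commute)
  ultimately show ?thesis
    using \<mu>
    unfolding majorant_def inner_gradient_smooth_part[OF f] r_def[symmetric] w_def[symmetric]
    unfolding smooth_part_def r_def[symmetric]
    by (simp add: algebra_simps)
qed

section \<open>A lower bound for the penalised objective\<close>


lemma quadratic_lower_bound: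
  fixes V :: real
  assumes "0 < V"
  shows "- (P\<^sup>2 / (2 * V)) \<le> V / 2 * u\<^sup>2 - P * u"
proof -
  have "V / 2 * u\<^sup>2 - P * u + P\<^sup>2 / (2 * V) = (V * u - P)\<^sup>2 / (2 * V)"
    using assms by (simp add: field_simps power2_eq_square)
  also have "\<dots> \<ge> 0"
    using assms by simp
  finally show ?thesis
    by linarith
qed

text \<open>On sparse points \<open>f\<close> grows quadratically in \<open>\<parallel>x\<parallel>\<close>, by restricted strong convexity at 0, and the
  penalty is quadratic in the residual \<open>r = \<parallel>A x - b - y\<parallel>\<close>. The function \<open>h\<close> decreases at most
  linearly in \<open>\<parallel>y\<parallel> \<le> a \<parallel>x\<parallel> + \<parallel>b\<parallel> + r\<close>. Completing both squares bounds the sum; the loss in \<open>r\<close>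
  is proportional to \<open>\<mu>\<close>, whence the uniformity for \<open>\<mu> \<le> \<mu>0\<close>.\<close>

lemma objective_bounded_below:
  fixes A :: "real ^ 'n ^ 'm" and h :: "real ^ 'm \<Rightarrow> real"
  assumes V: "0 < V" and M: "restricted_strong_smooth s f V M"
    and h: "convex_on UNIV h"
    and A: "\<And>z z'. l0 z \<le> s \<Longrightarrow> l0 z' \<le> s \<Longrightarrow> norm (A *v (z - z')) \<le> a * norm (z - z')"
  obtains B where
    "\<And>x y \<mu>. l0 x \<le> s \<Longrightarrow> 0 < \<mu> \<Longrightarrow> \<mu> \<le> \<mu>0 \<Longrightarrow> B \<le> smooth_part f A b x y \<mu> + h y"
proof -
  obtain K where K: "0 \<le> K" "\<And>y. h 0 - K * (1 + norm y) \<le> h y"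
    using convex_linear_minorant[OF h, of 0] by auto
  define g where "g = norm (gradient f 0)"
  define P where "P = g + K * a"
  have l0_0: "l0 (0 :: real ^ 'n) \<le> s"
    by (simp add: l0_def)
  have "f 0 - P\<^sup>2 / (2 * V) + h 0 - K * (1 + norm b) - K\<^sup>2 * \<mu>0 / 2 \<le> smooth_part f A b x y \<mu> + h y"
    if x: "l0 x \<le> s" and \<mu>: "0 < \<mu>" "\<mu> \<le> \<mu>0" for x y \<mu>
  proof -
    define r where "r = norm (A *v x - b - y)"
    have "V / 2 * (norm x)\<^sup>2 \<le> f x - f 0 - x \<bullet> gradient f 0"
      using M[unfolded restricted_strong_smooth_def, rule_format, of 0 x] x l0_0 by simp
    moreover have "- (norm x * g) \<le> x \<bullet> gradient f 0"
      using Cauchy_Schwarz_ineq2[of x "gradient f 0"] by (simp add: g_def abs_le_iff)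
    ultimately have 1: "f 0 + V / 2 * (norm x)\<^sup>2 - g * norm x \<le> f x"
      by (simp add: mult.commute)
    have "norm y \<le> norm (A *v x - b) + r"
      unfolding r_def using norm_triangle_ineq4[of "A *v x - b" "A *v x - b - y"] by simp
    also have "norm (A *v x - b) \<le> norm (A *v x) + norm b"
      by (rule norm_triangle_ineq4)
    also have "norm (A *v x) \<le> a * norm x"
      using A[OF x l0_0] by simp
    finally have "K * norm y \<le> K * (a * norm x + norm b + r)"
      using K(1) by (intro mult_left_mono) auto
    then have 2: "h 0 - K * (1 + norm b) - K * a * norm x - K * r \<le> h y"
      using K(2)[of y] by (simp add: algebra_simps)
    have "- (P\<^sup>2 / (2 * V)) \<le> V / 2 * (norm x)\<^sup>2 - P * norm x"
      using V by (rule quadratic_lower_bound)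
    moreover have "- (K\<^sup>2 / (2 * (1 / \<mu>))) \<le> 1 / \<mu> / 2 * r\<^sup>2 - K * r"
      using \<mu> by (intro quadratic_lower_bound) simp
    moreover have "K\<^sup>2 * \<mu> \<le> K\<^sup>2 * \<mu>0"
      using \<mu> by (intro mult_left_mono) auto
    ultimately show ?thesis
      using 1 2 unfolding smooth_part_def r_def[symmetric] P_def by (simp add: algebra_simps)
  qed
  then show ?thesis
    using that by blast
qed

section \<open>One iteration\<close>

text \<open>The penalised objective changes for three reasons: the \<open>x\<close>-step gains the surplus of the
  majorant, the \<open>y\<close>-step gains by strong convexity, and lowering the smoothing parameter from
  \<open>\<nu>\<close> to \<open>\<mu>\<close> costs \<open>(1/(2\<mu>) - 1/(2\<nu>)) \<parallel>A x - b - y\<parallel>\<^sup>2\<close>. Since \<open>y\<close> is a proximal point for \<open>\<nu>\<close>,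
  that residual is at most \<open>L \<nu>\<close>, and the cost is at most the term called \<open>\<Psi>\<close> in the theorem.\<close>

lemma spgm_iht_step_descent:
  fixes A :: "real ^ 'n ^ 'm" and h :: "real ^ 'm \<Rightarrow> real"
  assumes f: "f differentiable (at x)"
    and M: "restricted_strong_smooth s f V M"
    and A: "\<And>z z'. l0 z \<le> s \<Longrightarrow> l0 z' \<le> s \<Longrightarrow> norm (A *v (z - z')) \<le> a * norm (z - z')"
    and h: "convex_on UNIV h"
    and L: "\<And>z g. g \<in> subdifferential h z \<Longrightarrow> norm g \<le> L"
    and \<mu>: "0 < \<mu>" "\<mu> \<le> \<nu>"
    and x: "l0 x \<le> s" and y: "y = prox h \<nu> (A *v x - b)"
    and x': "is_arg_min (\<lambda>z. majorant f A b a M \<theta> z x y \<mu>) (\<lambda>z. l0 z \<le> s) x'"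
    and y': "y' = prox h \<mu> (A *v x' - b)"
  shows "\<theta> / 2 * (norm (x' - x))\<^sup>2 + 1 / (2 * \<mu>) * (norm (y' - y))\<^sup>2
    \<le> L\<^sup>2 / 2 * (\<nu>\<^sup>2 / \<mu> - \<nu>) + (smooth_part f A b x y \<nu> + h y)
      - (smooth_part f A b x' y' \<mu> + h y')"
proof -
  have \<nu>: "0 < \<nu>"
    using \<mu> by simp
  have sparse: "l0 x' \<le> s"
    using x' by (simp add: is_arg_min_def)
  have "smooth_part f A b x' y \<mu> + \<theta> / 2 * (norm (x' - x))\<^sup>2 \<le> majorant f A b a M \<theta> x' x y \<mu>"
    by (rule majorant_ge_smooth_part[OF f M A \<mu>(1) x sparse])
  also have "\<dots> \<le> majorant f A b a M \<theta> x x y \<mu>"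
    using x' x by (auto simp: is_arg_min_linorder)
  also have "\<dots> = smooth_part f A b x y \<mu>"
    by (simp add: majorant_def)
  finally have x_step:
    "smooth_part f A b x' y \<mu> + \<theta> / 2 * (norm (x' - x))\<^sup>2 \<le> smooth_part f A b x y \<mu>" .
  have y_step: "smooth_part f A b x' y' \<mu> + h y' + 1 / (2 * \<mu>) * (norm (y' - y))\<^sup>2
      \<le> smooth_part f A b x' y \<mu> + h y"
    using prox_strong_minimizer[OF h \<mu>(1), of "A *v x' - b" y]
    unfolding smooth_part_def y'[symmetric] by (simp add: norm_minus_commute)
  define r where "r = norm (A *v x - b - y)"
  have "r \<le> L * \<nu>"
    unfolding r_def y by (rule prox_residual_bound[OF h \<nu> L])
  then have "r\<^sup>2 \<le> (L * \<nu>)\<^sup>2"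
    by (intro power_mono) (simp_all add: r_def)
  moreover have "0 \<le> 1 / (2 * \<mu>) - 1 / (2 * \<nu>)"
    using \<mu> \<nu> by (simp add: frac_le)
  ultimately have "(1 / (2 * \<mu>) - 1 / (2 * \<nu>)) * r\<^sup>2 \<le> (1 / (2 * \<mu>) - 1 / (2 * \<nu>)) * (L * \<nu>)\<^sup>2"
    by (rule mult_left_mono)
  also have "\<dots> = L\<^sup>2 / 2 * (\<nu>\<^sup>2 / \<mu> - \<nu>)"
    using \<mu> \<nu> by (simp add: field_simps power2_eq_square)
  finally have "smooth_part f A b x y \<mu>
      \<le> smooth_part f A b x y \<nu> + L\<^sup>2 / 2 * (\<nu>\<^sup>2 / \<mu> - \<nu>)"
    unfolding smooth_part_def r_def[symmetric] by (simp only: left_diff_distrib)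
  with x_step y_step show ?thesis
    by linarith
qed

text \<open>The next iterate \<open>x'\<close> witnesses the distance in the \<open>x\<close>-component. The \<open>y\<close>-component needs care:
  \<open>y\<close> is the proximal point of \<open>A x - b\<close> for the previous parameter \<open>\<nu>\<close>, whereas stationarity asks
  for \<open>\<mu>\<close>. The distance is thus that between two proximal points of the same vector, not between
  successive iterates.\<close>

lemma approx_lipschitz_stationary_iterate:
  fixes A :: "real ^ 'n ^ 'm" and h :: "real ^ 'm \<Rightarrow> real"
  assumes h: "convex_on UNIV h"
    and L: "\<And>z g. g \<in> subdifferential h z \<Longrightarrow> norm g \<le> L"
    and \<mu>: "0 < \<mu>" "\<mu> \<le> \<nu>"
    and x: "l0 x \<le> s" and y: "y = prox h \<nu> (A *v x - b)"
    and x': "is_arg_min (\<lambda>z. majorant f A b a M \<theta> z x y \<mu>) (\<lambda>z. l0 z \<le> s) x'"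
    and small: "(norm (x' - x))\<^sup>2 + (L * (\<nu> - \<mu>))\<^sup>2 \<le> \<epsilon>"
  shows "approx_lipschitz_stationary f h A b s a M \<theta> \<epsilon> \<mu> x y"
proof -
  define Y where "Y = {z. is_arg_min (\<lambda>z. penalty f h A b s x z \<mu>) (\<lambda>_. True) z}"
  define X where "X = {z. is_arg_min (\<lambda>z. sparse_ind s z + ereal (majorant f A b a M \<theta> z x y \<mu>))
    (\<lambda>_. True) z}"
  define p where "p = prox h \<mu> (A *v x - b)"
  have "smooth_part f A b x p \<mu> + h p \<le> smooth_part f A b x z \<mu> + h z" for z
    using prox_minimizes[OF h \<mu>(1), of "A *v x - b" z]
    unfolding smooth_part_def p_def[symmetric] by linarith
  then have p: "p \<in> Y"
    using x by (simp add: Y_def is_arg_min_linorder penalty_def sparse_ind_def)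
  have "l0 x' \<le> s" "\<And>z. l0 z \<le> s \<Longrightarrow> majorant f A b a M \<theta> x' x y \<mu> \<le> majorant f A b a M \<theta> z x y \<mu>"
    using x' by (auto simp: is_arg_min_linorder)
  then have x'_X: "x' \<in> X"
    by (auto simp: X_def is_arg_min_linorder sparse_ind_def)
  have "infdist y Y \<le> norm (y - p)"
    using infdist_le[OF p, of y] by (simp add: dist_norm)
  also have "\<dots> \<le> L * (\<nu> - \<mu>)"
    unfolding y p_def by (rule prox_parameter_lipschitz[OF h \<mu> L])
  finally have "(infdist y Y)\<^sup>2 \<le> (L * (\<nu> - \<mu>))\<^sup>2"
    by (intro power_mono infdist_nonneg)
  moreover have "infdist x X \<le> norm (x' - x)"
    using infdist_le[OF x'_X, of x] by (simp add: dist_norm norm_minus_commute)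
  then have "(infdist x X)\<^sup>2 \<le> (norm (x' - x))\<^sup>2"
    by (intro power_mono infdist_nonneg)
  ultimately have "(infdist y Y)\<^sup>2 + (infdist x X)\<^sup>2 \<le> \<epsilon>"
    using small by linarith
  then show ?thesis
    using p x'_X unfolding approx_lipschitz_stationary_def X_def Y_def by (auto simp: Let_def)
qed

section \<open>The parameter schedules\<close>


lemma schedule_pos:
  assumes "0 < \<eta>" "constant_schedule \<mu> \<or> diminishing_schedule \<eta> \<mu>"
  shows "0 < \<mu> t"
  using assms by (auto simp: constant_schedule_def diminishing_schedule_def)

lemma schedule_antimono:
  assumes "0 < \<eta>" "constant_schedule \<mu> \<or> diminishing_schedule \<eta> \<mu>" "t \<le> u"
  shows "\<mu> u \<le> \<mu> t"
  using assms by (auto simp: constant_schedule_def diminishing_schedule_def frac_le)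

text \<open>The constant \<open>\<eta> L\<^sup>2\<close> pays for the sum of the \<open>\<Psi>\<close> terms and for the squared drift of the
  proximal points together. For the diminishing schedule put \<open>k = t - 1 + c\<close>, where \<open>c\<close> is the
  offset. The \<open>\<Psi>\<close> term is \<open>\<eta> L\<^sup>2 / 2\<close> times \<open>1 / k\<^sup>2\<close>, and the drift term, by \<open>c \<le> k\<close>, is at most
  \<open>\<eta> L\<^sup>2 / 2\<close> times \<open>1 / (k (k + 1)\<^sup>2)\<close>. These two add up to \<open>\<phi> k - \<phi> (k + 1)\<close> for
  \<open>\<phi> k = 1 / k + 1 / k\<^sup>2\<close>, so the total telescopes to at most \<open>\<eta> L\<^sup>2 / 2\<close> times \<open>\<phi> c \<le> 2\<close>.\<close>

lemma schedule_drift_sum_le: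
  assumes \<eta>: "0 < \<eta>" and sched: "constant_schedule \<mu> \<or> diminishing_schedule \<eta> \<mu>"
  shows "(\<Sum>t=1..T. Psi L \<mu> t + 1 / (2 * \<mu> 0) * (L * (\<mu> (t - 1) - \<mu> t))\<^sup>2) \<le> \<eta> * L\<^sup>2"
  using sched
proof
  assume "constant_schedule \<mu>"
  then have "Psi L \<mu> t + 1 / (2 * \<mu> 0) * (L * (\<mu> (t - 1) - \<mu> t))\<^sup>2 = 0" for t
    by (auto simp: constant_schedule_def Psi_def power2_eq_square)
  then show ?thesis
    using \<eta> by simp
next
  assume "diminishing_schedule \<eta> \<mu>"
  then obtain c where c: "1 \<le> c" "\<And>t. \<mu> t = \<eta> / (real t + c)"
    by (auto simp: diminishing_schedule_def)
  define \<phi> where "\<phi> k = 1 / k + 1 / k\<^sup>2" for k :: real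
  have term_le: "Psi L \<mu> (Suc m) + 1 / (2 * \<mu> 0) * (L * (\<mu> m - \<mu> (Suc m)))\<^sup>2
      \<le> \<eta> * L\<^sup>2 / 2 * (\<phi> (real m + c) - \<phi> (real (Suc m) + c))" for m
  proof -
    define k where "k = real m + c"
    have k: "1 \<le> k" "c \<le> k" "0 < k"
      using c(1) by (simp_all add: k_def)
    have \<mu>: "\<mu> m = \<eta> / k" "\<mu> (Suc m) = \<eta> / (k + 1)" "\<mu> 0 = \<eta> / c"
      by (simp_all add: c(2) k_def algebra_simps)
    have "Psi L \<mu> (Suc m) = \<eta> * L\<^sup>2 / 2 * (1 / k\<^sup>2)"
      unfolding Psi_def using \<eta> k by (simp add: \<mu> field_simps power2_eq_square)
    moreover have "\<eta> / k - \<eta> / (k + 1) = \<eta> / (k * (k + 1))"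
      using k by (simp add: field_simps)
    then have "1 / (2 * \<mu> 0) * (L * (\<mu> m - \<mu> (Suc m)))\<^sup>2
        = \<eta> * L\<^sup>2 / 2 * (c / (k\<^sup>2 * (k + 1)\<^sup>2))"
      using \<eta> k c(1) by (simp add: \<mu> power2_eq_square mult_ac)
    moreover have "c / (k\<^sup>2 * (k + 1)\<^sup>2) \<le> k / (k\<^sup>2 * (k + 1)\<^sup>2)"
      using k by (intro divide_right_mono) auto
    then have "\<eta> * L\<^sup>2 / 2 * (c / (k\<^sup>2 * (k + 1)\<^sup>2)) \<le> \<eta> * L\<^sup>2 / 2 * (k / (k\<^sup>2 * (k + 1)\<^sup>2))"
      using \<eta> by (intro mult_left_mono) auto
    moreover have "1 / k\<^sup>2 + k / (k\<^sup>2 * (k + 1)\<^sup>2) = \<phi> k - \<phi> (k + 1)"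
      using k unfolding \<phi>_def by (simp add: divide_simps) algebra
    moreover have "real (Suc m) + c = k + 1"
      by (simp add: k_def)
    ultimately show ?thesis
      unfolding k_def[symmetric] by (metis (no_types, lifting) add_left_mono distrib_left)
  qed
  have "(\<Sum>t=1..T. Psi L \<mu> t + 1 / (2 * \<mu> 0) * (L * (\<mu> (t - 1) - \<mu> t))\<^sup>2)
      = (\<Sum>m<T. Psi L \<mu> (Suc m) + 1 / (2 * \<mu> 0) * (L * (\<mu> m - \<mu> (Suc m)))\<^sup>2)"
    by (rule sum.reindex_bij_witness[of _ Suc "\<lambda>t. t - 1"]) auto
  also have "\<dots> \<le> (\<Sum>m<T. \<eta> * L\<^sup>2 / 2 * (\<phi> (real m + c) - \<phi> (real (Suc m) + c)))"
    by (intro sum_mono term_le)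
  also have "\<dots> = \<eta> * L\<^sup>2 / 2 * (\<phi> c - \<phi> (real T + c))"
    using sum_lessThan_telescope'[of "\<lambda>m. \<phi> (real m + c)" T]
    by (simp only: sum_distrib_left[symmetric] of_nat_0 add_0)
  also have "\<dots> \<le> \<eta> * L\<^sup>2 / 2 * 2"
  proof (intro mult_left_mono)
    have "1 / c \<le> 1" "1 / c\<^sup>2 \<le> 1"
      using c(1) by (simp_all add: divide_simps)
    moreover have "0 \<le> \<phi> (real T + c)"
      using c(1) by (simp add: \<phi>_def)
    ultimately show "\<phi> c - \<phi> (real T + c) \<le> 2"
      by (simp add: \<phi>_def)
  qed (use \<eta> in simp)
  finally show ?thesis
    by simp
qed

section \<open>Convergence\<close>

theorem theorem4p4:
  fixes A :: "real ^ 'n ^ 'm" and b :: "real ^ 'm" and s :: nat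
    and f :: "real ^ 'n \<Rightarrow> real" and h :: "real ^ 'm \<Rightarrow> real"
    and Lf Lh Vs Ms As \<theta> \<eta> :: real and Mt :: "real ^ 'n ^ 'n"
    and X :: "(real ^ 'n) set"
    and \<mu> :: "nat \<Rightarrow> real" and x :: "nat \<Rightarrow> real ^ 'n" and y :: "nat \<Rightarrow> real ^ 'm"
  assumes s: "1 \<le> s" "s \<le> CARD('n)"
    and f_smooth: "\<And>z. f differentiable (at z)" "continuous_on UNIV (gradient f)"
    and f_convex: "convex_on UNIV f"
    and h_convex: "convex_on UNIV h"
    and grad_bound: "gradient_bounded_on X s f Lf" "\<And>t. 1 \<le> t \<Longrightarrow> x t \<in> X"
    and subgrad_bound: "\<And>z g. g \<in> subdifferential h z \<Longrightarrow> norm g \<le> Lh"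
    and VM: "0 < Vs" "0 < Ms" "restricted_strong_smooth s f Vs Ms"
    and Mt: "matrix_majorized s f Vs Ms Mt"
    and As: "0 < As"
      "\<And>z z'. l0 z \<le> s \<Longrightarrow> l0 z' \<le> s \<Longrightarrow> norm (A *v (z - z')) \<le> As * norm (z - z')"
    and theta: "0 < \<theta>"
    and eta: "0 < \<eta>"
    and schedule: "constant_schedule \<mu> \<or> diminishing_schedule \<eta> \<mu>"
    and alg: "spgm_iht f h A b s As Ms \<theta> \<mu> x y"
  shows
    "(\<forall>t\<ge>1.
       ereal (\<theta> / 2 * (norm (x (t + 1) - x t))\<^sup>2 + 1 / (2 * \<mu> 0) * (norm (y (t + 1) - y t))\<^sup>2)
       \<le> ereal (Psi Lh \<mu> t) + J_iter f h A b s \<mu> x y t - J_iter f h A b s \<mu> x y (t + 1))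
     \<and>
     (\<forall>T\<ge>1.
       ereal (\<Sum>t=1..T. \<theta> / 2 * (norm (x (t + 1) - x t))\<^sup>2
                       + 1 / (2 * \<mu> 0) * (norm (y (t + 1) - y t))\<^sup>2)
       \<le> C_bound f h A b s Lh \<eta> \<mu> x y T
       \<and> C_bound f h A b s Lh \<eta> \<mu> x y T < \<infinity>)
     \<and>
     (\<forall>\<epsilon>>0. \<forall>T\<ge>1.
       2 * C_bound f h A b s Lh \<eta> \<mu> x y T / ereal (\<epsilon> * min \<theta> (inverse (\<mu> 0))) \<le> ereal (real T)
       \<longrightarrow> (\<exists>tb\<in>{1..T}.
              approx_lipschitz_stationary f h A b s As Ms \<theta> \<epsilon> (\<mu> tb) (x tb) (y tb)))
     \<and>
     (\<exists>N :: real \<Rightarrow> nat.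
       (\<forall>\<epsilon>>0. 1 \<le> N \<epsilon> \<and>
          2 * C_bound f h A b s Lh \<eta> \<mu> x y (N \<epsilon>) / ereal (\<epsilon> * min \<theta> (inverse (\<mu> 0)))
          \<le> ereal (real (N \<epsilon>)))
       \<and> (\<lambda>\<epsilon>. real (N \<epsilon>)) \<in> O[at_right 0](\<lambda>\<epsilon>. 1 / \<epsilon>))"
proof -
  have \<mu>_pos: "0 < \<mu> t" for t
    using schedule_pos[OF eta schedule] .
  have \<mu>_anti: "\<mu> u \<le> \<mu> t" if "t \<le> u" for t u
    using schedule_antimono[OF eta schedule that] .
  have sparse: "l0 (x t) \<le> s" if "1 \<le> t" for t
    using alg that unfolding spgm_iht_def is_arg_min_def
    by (cases "t = 1") (auto dest: spec[of _ "t - 1"])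
  have y_prox: "y t = prox h (\<mu> (t - 1)) (A *v x t - b)" if "1 \<le> t" for t
    using alg that unfolding spgm_iht_def
    by (cases "t = 1") (auto dest: spec[of _ "t - 1"])
  have x_argmin: "is_arg_min (\<lambda>z. majorant f A b As Ms \<theta> z (x t) (y t) (\<mu> t))
      (\<lambda>z. l0 z \<le> s) (x (t + 1))" if "1 \<le> t" for t
    using alg that unfolding spgm_iht_def by blast
  have y_next: "y (t + 1) = prox h (\<mu> t) (A *v x (t + 1) - b)" if "1 \<le> t" for t
    using alg that unfolding spgm_iht_def by blast

  define J where "J t = smooth_part f A b (x t) (y t) (\<mu> (t - 1)) + h (y t)" for t
  have J_iter: "J_iter f h A b s \<mu> x y t = ereal (J t)" if "1 \<le> t" for t
    using sparse[OF that] by (simp add: J_iter_def penalty_def sparse_ind_def J_def)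
  define C where "C T = J 1 - J (T + 1) + \<eta> * Lh\<^sup>2" for T
  have C_bound: "C_bound f h A b s Lh \<eta> \<mu> x y T = ereal (C T)" for T
    by (simp add: C_bound_def J_iter C_def)

  define dx where "dx t = (norm (x (t + 1) - x t))\<^sup>2" for t
  define dy where "dy t = (norm (y (t + 1) - y t))\<^sup>2" for t
  define drift where "drift t = (Lh * (\<mu> (t - 1) - \<mu> t))\<^sup>2" for t

  have descent: "\<theta> / 2 * dx t + 1 / (2 * \<mu> 0) * dy t \<le> Psi Lh \<mu> t + J t - J (t + 1)"
    if t: "1 \<le> t" for t
  proof -
    have "\<theta> / 2 * dx t + 1 / (2 * \<mu> t) * dy t \<le> Psi Lh \<mu> t + J t - J (t + 1)"
      using spgm_iht_step_descent[OF f_smooth(1) VM(3) As(2) h_convex subgrad_bound \<mu>_pos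
          \<mu>_anti sparse[OF t] y_prox[OF t] x_argmin[OF t] y_next[OF t]]
      by (simp add: J_def Psi_def dx_def dy_def)
    moreover have "1 / (2 * \<mu> 0) * dy t \<le> 1 / (2 * \<mu> t) * dy t"
      using \<mu>_pos \<mu>_anti[of 0 t] by (intro mult_right_mono frac_le) (auto simp: dy_def)
    ultimately show ?thesis
      by linarith
  qed
  have telescope: "(\<Sum>t=1..T. Psi Lh \<mu> t + J t - J (t + 1)) = (\<Sum>t=1..T. Psi Lh \<mu> t) + J 1 - J (T + 1)" for T
    by (induction T) auto

  (* The sum of the squared drifts is paid from the same budget as the sum of the \<Psi> terms, so the
     total bound is C both with dy and with the drift in its place. *)
  have drift_budget: "(\<Sum>t=1..T. Psi Lh \<mu> t) + (\<Sum>t=1..T. 1 / (2 * \<mu> 0) * drift t) \<le> \<eta> * Lh\<^sup>2" for T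
    using schedule_drift_sum_le[OF eta schedule, of Lh T] by (simp add: drift_def sum.distrib)
  have drift_nonneg: "0 \<le> (\<Sum>t=1..T. 1 / (2 * \<mu> 0) * drift t)" for T
    using \<mu>_pos[of 0] by (intro sum_nonneg) (auto simp: drift_def)

  have sum_descent: "(\<Sum>t=1..T. \<theta> / 2 * dx t + 1 / (2 * \<mu> 0) * dy t) \<le> (\<Sum>t=1..T. Psi Lh \<mu> t) + J 1 - J (T + 1)" for T
    unfolding telescope[symmetric] by (intro sum_mono descent) simp
  have sum_dy: "(\<Sum>t=1..T. \<theta> / 2 * dx t + 1 / (2 * \<mu> 0) * dy t) \<le> C T" for T
    using sum_descent[of T] drift_budget[of T] drift_nonneg[of T] by (simp add: C_def)
  have sum_drift: "(\<Sum>t=1..T. \<theta> / 2 * dx t + 1 / (2 * \<mu> 0) * drift t) \<le> C T" for T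
  proof -
    have "(\<Sum>t=1..T. \<theta> / 2 * dx t) \<le> (\<Sum>t=1..T. \<theta> / 2 * dx t + 1 / (2 * \<mu> 0) * dy t)"
      using \<mu>_pos[of 0] by (intro sum_mono) (auto simp: dy_def)
    then show ?thesis
      using sum_descent[of T] drift_budget[of T] by (simp add: C_def sum.distrib)
  qed

  define m where "m = min \<theta> (inverse (\<mu> 0))"
  have m: "0 < m" "m \<le> \<theta>" "m \<le> 1 / \<mu> 0"
    using theta \<mu>_pos[of 0] by (auto simp: m_def inverse_eq_divide)

  have stationary: "\<exists>t\<in>{1..T}. approx_lipschitz_stationary f h A b s As Ms \<theta> \<epsilon> (\<mu> t) (x t) (y t)"
    if \<epsilon>: "0 < \<epsilon>" and T: "1 \<le> T" "2 * C T / (\<epsilon> * m) \<le> real T" for \<epsilon> T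
  proof -
    have "\<exists>t\<in>{1..T}. dx t + drift t \<le> \<epsilon>"
    proof (rule ccontr)
      assume "\<not> ?thesis"
      then have large: "\<epsilon> < dx t + drift t" if "t \<in> {1..T}" for t
        using that by (meson not_le)
      have "m / 2 * \<epsilon> < \<theta> / 2 * dx t + 1 / (2 * \<mu> 0) * drift t" if "t \<in> {1..T}" for t
      proof -
        have "m / 2 * \<epsilon> < m / 2 * (dx t + drift t)"
          using large[OF that] m by simp
        moreover have "m / 2 * dx t \<le> \<theta> / 2 * dx t" "m / 2 * drift t \<le> 1 / \<mu> 0 / 2 * drift t"
          using m by (intro mult_right_mono divide_right_mono; simp add: dx_def drift_def)+
        ultimately show ?thesis
          by (simp add: algebra_simps)
      qed
      then have "(\<Sum>t=1..T. m / 2 * \<epsilon>) < (\<Sum>t=1..T. \<theta> / 2 * dx t + 1 / (2 * \<mu> 0) * drift t)"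
        using T by (intro sum_strict_mono) auto
      then have "real T * (m / 2 * \<epsilon>) < C T"
        using sum_drift[of T] by simp
      moreover have "2 * C T \<le> real T * (\<epsilon> * m)"
        using T(2) \<epsilon> m by (simp add: pos_divide_le_eq)
      ultimately show False
        by (simp add: algebra_simps)
    qed
    then obtain t where t: "1 \<le> t" "t \<le> T" "dx t + drift t \<le> \<epsilon>"
      by auto
    have "approx_lipschitz_stationary f h A b s As Ms \<theta> \<epsilon> (\<mu> t) (x t) (y t)"
      by (rule approx_lipschitz_stationary_iterate[OF h_convex subgrad_bound \<mu>_pos \<mu>_anti
          sparse[OF t(1)] y_prox[OF t(1)] x_argmin[OF t(1)] t(3)[unfolded dx_def drift_def]]) auto
    then show ?thesis
      using t by auto
  qed

  (* C T depends on T only through J (T + 1), which is bounded below; so one T of order 1 / \<epsilon>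
     satisfies the condition that involves C T itself. *)
  obtain B where B: "\<And>x y \<nu>. l0 x \<le> s \<Longrightarrow> 0 < \<nu> \<Longrightarrow> \<nu> \<le> \<mu> 0 \<Longrightarrow> B \<le> smooth_part f A b x y \<nu> + h y"
    using objective_bounded_below[OF VM(1,3) h_convex As(2)] by blast
  define D where "D = 2 * (J 1 - B + \<eta> * Lh\<^sup>2) / m"
  define N where "N \<epsilon> = nat \<lceil>D / \<epsilon>\<rceil> + 1" for \<epsilon>
  have N_large: "2 * C (N \<epsilon>) / (\<epsilon> * m) \<le> real (N \<epsilon>)" if \<epsilon>: "0 < \<epsilon>" for \<epsilon>
  proof -
    have "B \<le> J (N \<epsilon> + 1)"
      unfolding J_def using \<mu>_pos \<mu>_anti by (intro B sparse) auto
    then have "2 * C (N \<epsilon>) / (\<epsilon> * m) \<le> 2 * (J 1 - B + \<eta> * Lh\<^sup>2) / (\<epsilon> * m)"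
      using \<epsilon> m by (intro divide_right_mono) (auto simp: C_def)
    also have "\<dots> = D / \<epsilon>"
      by (simp add: D_def mult.commute)
    also have "\<dots> \<le> real (N \<epsilon>)"
      unfolding N_def using real_nat_ceiling_ge[of "D / \<epsilon>"] by simp
    finally show ?thesis .
  qed
  have N_bigo: "(\<lambda>\<epsilon>. real (N \<epsilon>)) \<in> O[at_right 0](\<lambda>\<epsilon>. 1 / \<epsilon>)"
  proof (rule bigoI)
    show "\<forall>\<^sub>F \<epsilon> in at_right 0. norm (real (N \<epsilon>)) \<le> (\<bar>D\<bar> + 2) * norm (1 / \<epsilon>)"
    proof (rule eventually_mono[OF eventually_at_right_real[of 0 1]])
      fix \<epsilon> :: real assume "\<epsilon> \<in> {0<..<1}"
      then have \<epsilon>: "0 < \<epsilon>" "\<epsilon> < 1"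
        by auto
      have "real (N \<epsilon>) \<le> \<bar>D / \<epsilon>\<bar> + 2"
        unfolding N_def by linarith
      also have "\<dots> \<le> \<bar>D\<bar> / \<epsilon> + 2 / \<epsilon>"
        using \<epsilon> by (simp add: abs_divide field_simps)
      finally show "norm (real (N \<epsilon>)) \<le> (\<bar>D\<bar> + 2) * norm (1 / \<epsilon>)"
        using \<epsilon> by (simp add: add_divide_distrib)
    qed simp
  qed

  have quotient: "2 * C_bound f h A b s Lh \<eta> \<mu> x y T / ereal (\<epsilon> * min \<theta> (inverse (\<mu> 0)))
      = ereal (2 * C T / (\<epsilon> * m))" if "0 < \<epsilon>" for \<epsilon> T
    using that m(1) unfolding C_bound m_def[symmetric]
    by (simp add: numeral_eq_ereal)
  show ?thesis
  proof (intro conjI allI impI)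
    fix t :: nat assume "1 \<le> t"
    then show "ereal (\<theta> / 2 * (norm (x (t + 1) - x t))\<^sup>2 + 1 / (2 * \<mu> 0) * (norm (y (t + 1) - y t))\<^sup>2)
        \<le> ereal (Psi Lh \<mu> t) + J_iter f h A b s \<mu> x y t - J_iter f h A b s \<mu> x y (t + 1)"
      using descent[of t] by (simp add: J_iter dx_def dy_def)
  next
    fix T :: nat
    show "ereal (\<Sum>t=1..T. \<theta> / 2 * (norm (x (t + 1) - x t))\<^sup>2
          + 1 / (2 * \<mu> 0) * (norm (y (t + 1) - y t))\<^sup>2) \<le> C_bound f h A b s Lh \<eta> \<mu> x y T"
      using sum_dy[of T] by (simp add: C_bound dx_def dy_def)
    show "C_bound f h A b s Lh \<eta> \<mu> x y T < \<infinity>"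
      by (simp add: C_bound)
  next
    fix \<epsilon> :: real and T :: nat
    assume \<epsilon>: "0 < \<epsilon>" and T: "1 \<le> T"
      and C_le: "2 * C_bound f h A b s Lh \<eta> \<mu> x y T / ereal (\<epsilon> * min \<theta> (inverse (\<mu> 0))) \<le> ereal (real T)"
    show "\<exists>tb\<in>{1..T}. approx_lipschitz_stationary f h A b s As Ms \<theta> \<epsilon> (\<mu> tb) (x tb) (y tb)"
      using C_le unfolding quotient[OF \<epsilon>] ereal_less_eq(3) by (rule stationary[OF \<epsilon> T])
  next
    show "\<exists>N :: real \<Rightarrow> nat.
       (\<forall>\<epsilon>>0. 1 \<le> N \<epsilon> \<and>
          2 * C_bound f h A b s Lh \<eta> \<mu> x y (N \<epsilon>) / ereal (\<epsilon> * min \<theta> (inverse (\<mu> 0)))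
          \<le> ereal (real (N \<epsilon>)))
       \<and> (\<lambda>\<epsilon>. real (N \<epsilon>)) \<in> O[at_right 0](\<lambda>\<epsilon>. 1 / \<epsilon>)"
      using N_large N_bigo quotient by (intro exI[of _ N]) (auto simp only: ereal_less_eq(3) N_def)
  qed
qed

end
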